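(* Let $n_1>0$, $n_2>0$ and let $t_1,t_2$ be real numbers such that $a:=t_1+\frac{n_1}{2}-1>0$ and $b:=t_2+\frac{n_2}{2}-1>0$, and let $\alpha\in(0,1)$. Then the Beta-Kotz Value-at-Risk at level $\alpha$ is unique in the interval $(0,1)$: the equation $$\frac{\Gamma(a+b)}{\Gamma(a)\Gamma(b)}\,\frac{v^{a}}{a}\;{}_2F_1(a,1-b;a+1;v)-\alpha=0$$ has exactly one solution $v$ in $(0,1)$.
   Context: The Beta-Kotz distribution with parameters $n_1,n_2,t_1,t_2$ has density $\frac{\Gamma(a+b)}{\Gamma(a)\Gamma(b)}x^{a-1}(1-x)^{b-1}$ on $(0,1)$, with $a=t_1+\frac{n_1}{2}-1$ and $b=t_2+\frac{n_2}{2}-1$. The Beta-Kotz Value-at-Risk $VaR\beta_\alpha(X)$ of a variable $X$ with this distribution, at level $\alpha\in(0,1)$, is a number $v\in(0,1)$ solving the equation displayed in the claim (equivalently $P(X\le v)=\alpha$). The Gauss hypergeometric function is ${}_2F_1(m,n;p;x)=\sum_{k=0}^\infty\frac{(m)_k(n)_k}{(p)_k\,k!}x^k$ for $|x|<1$, where $(m)_0=1$ and $(m)_k=m(m+1)\cdots(m+k-1)$; thus the left-hand side of the equation equals $\frac{\Gamma(a+b)}{\Gamma(a)\Gamma(b)}\sum_{k=0}^\infty\frac{(1-b)_k}{(a+k)\,k!}v^{a+k}-\alpha$. *)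

theory Defs
  imports "HOL-Analysis.Analysis"
begin

text \<open>
  The value is the actual sum of the series only inside its disc of convergence, that is for
  \<open>\<bar>x\<bar> < 1\<close>, and for \<open>p\<close> not a non-positive integer; no analytic continuation is intended.
\<close>

definition gauss_hypergeometric :: "real \<Rightarrow> real \<Rightarrow> real \<Rightarrow> real \<Rightarrow> real" where
  "gauss_hypergeometric m n p x = eval_fps (fps_hypergeo [m, n] [p] 1) x"

lemma gauss_hypergeometric_altdef:
  "gauss_hypergeometric m n p x =
     (\<Sum>k. pochhammer m k * pochhammer n k / (pochhammer p k * fact k) * x ^ k)"
  by (simp add: gauss_hypergeometric_def eval_fps_def)

end

theory Submission
  imports Defs
begin

text \<open>
  Termwise differentiation and the binomial series show that
  \<open>v powr a / a * 2F1(a, 1 - b; a + 1; v)\<close> is the incomplete beta integral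
  \<open>\<integral>\<^sub>0\<^sup>v t powr (a - 1) * (1 - t) powr (b - 1) dt\<close>. This integral is continuous in \<open>v\<close>, has a
  positive derivative on \<open>(0, 1)\<close>, and increases from \<open>0\<close> to \<open>Beta a b\<close>, so it takes the value
  \<open>\<alpha> * Beta a b\<close> exactly once.
\<close>

text \<open>Since 0 < (a)_k \<le> (a+1)_k, the k-th term is bounded in absolute value by that of the
  binomial series with exponent -c, which converges absolutely inside the unit disc.\<close>

lemma summable_gauss_hypergeometric_Suc:
  fixes a c x :: real
  assumes a: "a > 0" and x: "\<bar>x\<bar> < 1"
  shows "summable (\<lambda>k. pochhammer a k * pochhammer c k / (pochhammer (a + 1) k * fact k) * x ^ k)"
proof -
  obtain y where y: "\<bar>x\<bar> < y" "y < 1"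
    using dense[OF x] by blast
  have "summable (\<lambda>k. (- c gchoose k) * y ^ k)"
    using gen_binomial_real[of y "- c"] y by (auto simp: sums_iff)
  then have "summable (\<lambda>k. norm ((- c gchoose k) * x ^ k))"
    by (rule powser_insidea) (use y in auto)
  moreover have "norm (pochhammer a k * pochhammer c k / (pochhammer (a + 1) k * fact k) * x ^ k)
      \<le> norm ((- c gchoose k) * x ^ k)" for k
  proof -
    have pos: "0 < pochhammer a k"
      using a by (rule pochhammer_pos)
    have "pochhammer a k \<le> pochhammer (a + 1) k"
      unfolding pochhammer_prod by (rule prod_mono) (use a in auto)
    with pos have "\<bar>pochhammer a k / pochhammer (a + 1) k\<bar> \<le> 1"
      by simp
    then have "\<bar>pochhammer a k / pochhammer (a + 1) k\<bar> * \<bar>pochhammer c k / fact k * x ^ k\<bar>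
        \<le> 1 * \<bar>pochhammer c k / fact k * x ^ k\<bar>"
      by (rule mult_right_mono) simp
    then show ?thesis
      by (simp add: gbinomial_pochhammer abs_mult power_abs)
  qed
  ultimately show ?thesis
    by (rule summable_comparison_test'[where N = 0])
qed

text \<open>The operator a + x d/dx multiplies the k-th coefficient by a + k, which cancels the
  quotient (a)_k / (a+1)_k up to the factor a and leaves the binomial series. Not dividing by x
  keeps x = 0 included, as needed later for continuity there.\<close>

lemma gauss_hypergeometric_Suc_deriv:
  fixes a c x :: real
  assumes a: "a > 0" and x: "\<bar>x\<bar> < 1"
  obtains D where "(gauss_hypergeometric a c (a + 1) has_real_derivative D) (at x)"
    and "a * gauss_hypergeometric a c (a + 1) x + x * D = a * (1 - x) powr (- c)"
proof
  define h where "h = (\<lambda>k. pochhammer a k * pochhammer c k / (pochhammer (a + 1) k * fact k))"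
  have h: "gauss_hypergeometric a c (a + 1) = (\<lambda>x. \<Sum>k. h k * x ^ k)"
    by (simp add: gauss_hypergeometric_altdef h_def fun_eq_iff)
  have sm: "summable (\<lambda>k. h k * z ^ k)" if "norm z < 1" for z
    unfolding h_def using summable_gauss_hypergeometric_Suc[OF a] that by simp
  let ?D = "\<Sum>k. diffs h k * x ^ k"
  show "(gauss_hypergeometric a c (a + 1) has_real_derivative ?D) (at x)"
    unfolding h by (rule termdiffs_strong'[where K = 1]) (use sm x in auto)
  have "summable (\<lambda>k. diffs h k * x ^ k)"
    by (rule termdiff_converges[where K = 1]) (use sm x in auto)
  \<comment> \<open>The series is reindexed so that the factor x restores x^k. The truncated
    exponent at k = 0 is harmless because \<open>of_nat k\<close> vanishes there.\<close>
  then have "(\<lambda>k. x * (of_nat k * h k * x ^ (k - Suc 0))) sums (x * ?D)"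
    by (intro sums_mult diffs_equiv)
  moreover have "x * (of_nat k * h k * x ^ (k - Suc 0)) = of_nat k * h k * x ^ k" for k
    by (cases k) auto
  ultimately have "(\<lambda>k. of_nat k * h k * x ^ k) sums (x * ?D)"
    by simp
  moreover have "(\<lambda>k. a * (h k * x ^ k)) sums (a * gauss_hypergeometric a c (a + 1) x)"
    unfolding h by (intro sums_mult summable_sums sm) (use x in auto)
  ultimately have "(\<lambda>k. a * (h k * x ^ k) + of_nat k * h k * x ^ k) sums
      (a * gauss_hypergeometric a c (a + 1) x + x * ?D)"
    by (intro sums_add)
  moreover have "a * (h k * x ^ k) + of_nat k * h k * x ^ k = a * ((- c gchoose k) * (- x) ^ k)" for k
  proof -
    have "pochhammer (a + 1) k \<noteq> 0"
      using pochhammer_pos[of "a + 1" k] a by simp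
    \<comment> \<open>Both sides equal (a)_{k+1}, split off at its last and at its first
      factor.\<close>
    moreover have "(a + of_nat k) * pochhammer a k = a * pochhammer (a + 1) k"
      using pochhammer_rec[of a k] pochhammer_rec'[of a k] by simp
    ultimately have "(a + of_nat k) * (pochhammer a k / pochhammer (a + 1) k) = a"
      by simp
    then have "(a + of_nat k) * h k = a * (pochhammer c k / fact k)"
      unfolding h_def by (metis mult.assoc times_divide_times_eq)
    moreover have "(- c gchoose k) * (- x) ^ k = pochhammer c k / fact k * x ^ k"
    proof -
      have "(- c gchoose k) * (- x) ^ k = pochhammer c k / fact k * ((- 1) ^ k * (- x) ^ k)"
        by (simp add: gbinomial_pochhammer)
      also have "(- 1) ^ k * (- x) ^ k = x ^ k"
        by (simp flip: power_mult_distrib)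
      finally show ?thesis .
    qed
    ultimately show ?thesis
      by (metis distrib_right mult.assoc)
  qed
  moreover have "(\<lambda>k. a * ((- c gchoose k) * (- x) ^ k)) sums (a * (1 - x) powr (- c))"
    using sums_mult[OF gen_binomial_real[of "- x" "- c"]] x by simp
  ultimately show "a * gauss_hypergeometric a c (a + 1) x + x * ?D = a * (1 - x) powr (- c)"
    using sums_unique2 by simp
qed

text \<open>By the product rule the derivative is v^(a-1)/a times (a G + v G'), where G is the
  hypergeometric factor. The preceding identity with c = 1 - b evaluates the bracket.\<close>

lemma incomplete_beta_series_deriv:
  fixes a b v :: real
  assumes a: "a > 0" and v: "0 < v" "v < 1"
  shows "((\<lambda>v. v powr a / a * gauss_hypergeometric a (1 - b) (a + 1) v) has_real_derivative
    v powr (a - 1) * (1 - v) powr (b - 1)) (at v)"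
proof -
  obtain D where D: "(gauss_hypergeometric a (1 - b) (a + 1) has_real_derivative D) (at v)"
    and eq: "a * gauss_hypergeometric a (1 - b) (a + 1) v + v * D = a * (1 - v) powr (- (1 - b))"
    using gauss_hypergeometric_Suc_deriv[of a v "1 - b"] a v by auto
  have p: "v powr a = v * v powr (a - 1)"
    using v by (simp add: powr_diff)
  have "v powr (a - 1) * gauss_hypergeometric a (1 - b) (a + 1) v + v powr a / a * D
      = v powr (a - 1) / a * (a * gauss_hypergeometric a (1 - b) (a + 1) v + v * D)"
    unfolding p using a by (simp add: field_simps)
  also have "\<dots> = v powr (a - 1) * (1 - v) powr (b - 1)"
    unfolding eq using a by simp
  finally have e: "v powr (a - 1) * gauss_hypergeometric a (1 - b) (a + 1) v + v powr a / a * D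
      = v powr (a - 1) * (1 - v) powr (b - 1)" .
  have "((\<lambda>v. v powr a / a) has_real_derivative v powr (a - 1)) (at v)"
    using a v by (auto intro!: derivative_eq_intros)
  from DERIV_mult[OF this D] show ?thesis
    using e by (simp add: algebra_simps)
qed

text \<open>For a < 1 the integrand is unbounded near 0, so the form of the fundamental theorem is
  used that asks for derivatives only in the interior and continuity on the closed interval. As a >
  0, the antiderivative is continuous at 0 and vanishes there.\<close>

lemma has_integral_incomplete_beta:
  fixes a b v :: real
  assumes a: "a > 0" and v: "0 \<le> v" "v < 1"
  shows "((\<lambda>t. t powr (a - 1) * (1 - t) powr (b - 1)) has_integral
    v powr a / a * gauss_hypergeometric a (1 - b) (a + 1) v) {0..v}"
proof -
  let ?F = "\<lambda>v. v powr a / a * gauss_hypergeometric a (1 - b) (a + 1) v"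
  have "isCont (gauss_hypergeometric a (1 - b) (a + 1)) x" if "x \<in> {0..v}" for x
  proof -
    have "\<bar>x\<bar> < 1"
      using v that by auto
    with a obtain D where "(gauss_hypergeometric a (1 - b) (a + 1) has_real_derivative D) (at x)"
      by (rule gauss_hypergeometric_Suc_deriv)
    then show ?thesis
      by (rule DERIV_isCont)
  qed
  then have "continuous_on {0..v} (gauss_hypergeometric a (1 - b) (a + 1))"
    by (simp add: continuous_at_imp_continuous_on)
  then have "continuous_on {0..v} ?F"
    using a by (intro continuous_intros continuous_on_powr') auto
  moreover have "(?F has_vector_derivative t powr (a - 1) * (1 - t) powr (b - 1)) (at t)"
    if "t \<in> {0<..<v}" for t
    using incomplete_beta_series_deriv[of a t b] a v that
    by (simp add: has_real_derivative_iff_has_vector_derivative)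
  ultimately show ?thesis
    using fundamental_theorem_of_calculus_interior[of 0 v ?F] v by simp
qed

theorem theorem4p2:
  fixes n1 n2 t1 t2 a b \<alpha> :: real
  assumes "n1 > 0" and "n2 > 0"
    and "a = t1 + n1 / 2 - 1" and "b = t2 + n2 / 2 - 1"
    and "a > 0" and "b > 0"
    and "0 < \<alpha>" and "\<alpha> < 1"
  shows "\<exists>!v. v \<in> {0<..<1} \<and>
           Gamma (a + b) / (Gamma a * Gamma b) * (v powr a / a)
             * gauss_hypergeometric a (1 - b) (a + 1) v - \<alpha> = 0"
proof -
  note a = \<open>a > 0\<close> and b = \<open>b > 0\<close>
  let ?f = "\<lambda>t. t powr (a - 1) * (1 - t) powr (b - 1)"
  let ?F = "\<lambda>v. v powr a / a * gauss_hypergeometric a (1 - b) (a + 1) v"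
  \<comment> \<open>The integral replaces \<open>?F\<close> at v = 1, outside the open disc, so that
    the intermediate value theorem applies on the closed unit interval.\<close>
  define I where "I = (\<lambda>v. integral {0..v} ?f)"
  have B: "Beta a b > 0"
    using a b by (simp add: Beta_def Gamma_real_pos)
  have I_eq: "I v = ?F v" if "0 \<le> v" "v < 1" for v
    unfolding I_def using has_integral_incomplete_beta[OF a that] by (rule integral_unique)
  have I0: "I 0 = 0" and I1: "I 1 = Beta a b"
    using has_integral_Beta_real[OF a b] by (simp_all add: I_def integral_unique)
  \<comment> \<open>Continuity up to v = 1 follows from integrability on the whole interval, even if
    the integrand is unbounded at an endpoint.\<close>
  have cont: "continuous_on {0..1} I"
    unfolding I_def using has_integral_Beta_real[OF a b]
    by (intro indefinite_integral_continuous_1) (auto simp: has_integral_integrable)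
  have mono: "?F u < ?F v" if "0 < u" "u < v" "v < 1" for u v
  proof (rule DERIV_pos_imp_increasing[OF \<open>u < v\<close>])
    fix x assume "u \<le> x" "x \<le> v"
    then show "\<exists>y. (?F has_real_derivative y) (at x) \<and> y > 0"
      using incomplete_beta_series_deriv[OF a, of x b] that by (intro exI[of _ "?f x"]) auto
  qed
  have eq: "Gamma (a + b) / (Gamma a * Gamma b) * (v powr a / a)
      * gauss_hypergeometric a (1 - b) (a + 1) v - \<alpha> = 0 \<longleftrightarrow> ?F v = \<alpha> * Beta a b" for v
  proof -
    have "Gamma (a + b) / (Gamma a * Gamma b) = 1 / Beta a b"
      by (simp add: Beta_def)
    then have "Gamma (a + b) / (Gamma a * Gamma b) * (v powr a / a)
      * gauss_hypergeometric a (1 - b) (a + 1) v = ?F v / Beta a b"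
      by simp
    then show ?thesis
      using B by (simp add: divide_eq_eq del: times_divide_eq_left)
  qed
  have \<alpha>: "0 < \<alpha> * Beta a b" "\<alpha> * Beta a b < Beta a b"
    using B \<open>0 < \<alpha>\<close> \<open>\<alpha> < 1\<close> by simp_all
  obtain v where v: "0 \<le> v" "v \<le> 1" "I v = \<alpha> * Beta a b"
    using IVT'[of I 0 "\<alpha> * Beta a b" 1] cont \<alpha> I0 I1 by (metis less_imp_le zero_le_one)
  \<comment> \<open>The target lies strictly between the endpoint values 0 and
    \<open>Beta a b\<close>; hence v is interior, where \<open>I\<close> agrees with the
    series.\<close>
  then have "v \<noteq> 0" "v \<noteq> 1"
    using \<alpha> I0 I1 by auto
  with v have v01: "v \<in> {0<..<1}" and Fv: "?F v = \<alpha> * Beta a b"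
    using I_eq[of v] by auto
  show ?thesis
    unfolding eq
  proof (rule ex1I[of _ v])
    show "v \<in> {0<..<1} \<and> ?F v = \<alpha> * Beta a b"
      using v01 Fv by blast
  next
    fix w assume w: "w \<in> {0<..<1} \<and> ?F w = \<alpha> * Beta a b"
    show "w = v"
      using mono[of v w] mono[of w v] v01 Fv w by (cases v w rule: linorder_cases) auto
  qed
qed

end
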